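(* Let $q$ be a prime power such that $q=1+16t^2$ for some integer $t$. Then there exists a $\left(q,2,\frac{q-1}{4},\frac{q-1}{16}\right)$-SEDF.
   Context: Let $G$ be a finite abelian group of order $n$, written multiplicatively, with identity $e$. For nonempty subsets $A_1,A_2\subseteq G$, let $\Delta_E(A_1,A_2)$ be the multiset $\{xy^{-1} : x\in A_1,\ y\in A_2\}$. Let $k,\lambda,m$ be positive integers. An $(n,m,k,\lambda)$-strong external difference family (SEDF) over $G$ is a collection $\{A_1,\dots,A_m\}$ of pairwise disjoint $k$-element subsets of $G$ such that for each $1\le j\le m$ the multiset union $\bigcup_{\ell\neq j}\Delta_E(A_\ell,A_j)$ equals $\lambda(G\setminus\{e\})$, i.e. contains every non-identity element of $G$ exactly $\lambda$ times and does not contain $e$. "There exists an $(n,m,k,\lambda)$-SEDF" means that one exists over some finite abelian group of order $n$. *)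

theory Defs
  imports "HOL-Algebra.Algebra" "HOL-Number_Theory.Prime_Powers" "HOL-Library.Multiset"
begin

definition delta_E :: "('a, 'b) monoid_scheme \<Rightarrow> 'a set \<Rightarrow> 'a set \<Rightarrow> 'a multiset" where
  "delta_E G A B = {# x \<otimes>\<^bsub>G\<^esub> inv\<^bsub>G\<^esub> y. (x, y) \<in># mset_set (A \<times> B) #}"

text \<open>The collection is given as a family \<open>A\<close> of which only the members with index in
  \<open>{1..m}\<close> matter. Multiset union adds multiplicities.\<close>

definition is_sedf ::
  "('a, 'b) monoid_scheme \<Rightarrow> nat \<Rightarrow> nat \<Rightarrow> nat \<Rightarrow> nat \<Rightarrow> (nat \<Rightarrow> 'a set) \<Rightarrow> bool" where
  "is_sedf G n m k l A \<longleftrightarrow>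
     comm_group G \<and> finite (carrier G) \<and> order G = n \<and>
     0 < m \<and> 0 < k \<and> 0 < l \<and>
     (\<forall>j\<in>{1..m}. A j \<subseteq> carrier G \<and> card (A j) = k) \<and>
     disjoint_family_on A {1..m} \<and>
     (\<forall>j\<in>{1..m}. (\<Sum>i\<in>{1..m} - {j}. delta_E G (A i) (A j)) =
        repeat_mset l (mset_set (carrier G - {\<one>\<^bsub>G\<^esub>})))"

text \<open>HOL cannot quantify existentially over types, so the carrier is taken among sets of natural
  numbers. As every finite group has an isomorphic copy there, nothing is lost; this is the
  content of \<open>is_sedf_imp_sedf_exists\<close> below.\<close>

definition sedf_exists :: "nat \<Rightarrow> nat \<Rightarrow> nat \<Rightarrow> nat \<Rightarrow> bool" where
  "sedf_exists n m k l \<longleftrightarrow> (\<exists>(G :: nat monoid) A. is_sedf G n m k l A)"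

lemma image_mset_sum: "image_mset f (\<Sum>i\<in>I. M i) = (\<Sum>i\<in>I. image_mset f (M i))"
  by (induction I rule: infinite_finite_induct) auto

lemma image_mset_repeat: "image_mset f (repeat_mset l M) = repeat_mset l (image_mset f M)"
  by (induction l) auto

lemma delta_E_iso:
  assumes "group G" "group H" "f \<in> iso G H" "A \<subseteq> carrier G" "B \<subseteq> carrier G"
  shows "delta_E H (f ` A) (f ` B) = image_mset f (delta_E G A B)"
proof -
  interpret group_hom G H f
    using assms by (auto simp: group_hom_def group_hom_axioms_def iso_def)
  have inj: "inj_on f (carrier G)"
    using assms(3) by (auto simp: iso_def bij_betw_def)
  have injp: "inj_on (map_prod f f) (A \<times> B)"
    using inj assms(4,5) by (intro map_prod_inj_on) (auto intro: inj_on_subset)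
  have "f ` A \<times> f ` B = map_prod f f ` (A \<times> B)"
    by auto
  then have "mset_set (f ` A \<times> f ` B) = image_mset (map_prod f f) (mset_set (A \<times> B))"
    by (simp add: image_mset_mset_set[OF injp])
  then have "delta_E H (f ` A) (f ` B)
      = {# f x \<otimes>\<^bsub>H\<^esub> inv\<^bsub>H\<^esub> f y. (x, y) \<in># mset_set (A \<times> B) #}"
    by (simp add: delta_E_def image_mset.compositionality o_def case_prod_unfold)
  also have "\<dots> = {# f (x \<otimes>\<^bsub>G\<^esub> inv\<^bsub>G\<^esub> y). (x, y) \<in># mset_set (A \<times> B) #}"
  proof (rule image_mset_cong)
    fix p assume "p \<in># mset_set (A \<times> B)"
    then have "p \<in> A \<times> B"
      by (cases "finite (A \<times> B)") auto
    then show "(case p of (x, y) \<Rightarrow> f x \<otimes>\<^bsub>H\<^esub> inv\<^bsub>H\<^esub> f y)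
        = (case p of (x, y) \<Rightarrow> f (x \<otimes>\<^bsub>G\<^esub> inv\<^bsub>G\<^esub> y))"
      using assms(4,5) by (auto simp: subset_iff)
  qed
  also have "\<dots> = image_mset f (delta_E G A B)"
    by (simp add: delta_E_def image_mset.compositionality o_def case_prod_unfold)
  finally show ?thesis .
qed

lemma is_sedf_iso:
  assumes S: "is_sedf G n m k l A" and H: "comm_group H" and f: "f \<in> iso G H"
  shows "is_sedf H n m k l (\<lambda>j. f ` A j)"
proof -
  have G: "comm_group G" and fin: "finite (carrier G)"
    and sub: "\<And>j. j \<in> {1..m} \<Longrightarrow> A j \<subseteq> carrier G"
    and dis: "disjoint_family_on A {1..m}"
    and dif: "\<And>j. j \<in> {1..m} \<Longrightarrow> (\<Sum>i\<in>{1..m} - {j}. delta_E G (A i) (A j)) =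
        repeat_mset l (mset_set (carrier G - {\<one>\<^bsub>G\<^esub>}))"
    using S by (auto simp: is_sedf_def)
  have gG: "group G" and gH: "group H"
    using G H by (auto simp: comm_group_def)
  interpret group_hom G H f
    using gG gH f by (auto simp: group_hom_def group_hom_axioms_def iso_def)
  have bij: "bij_betw f (carrier G) (carrier H)"
    using f by (auto simp: iso_def)
  then have inj: "inj_on f (carrier G)" and im: "f ` carrier G = carrier H"
    by (auto simp: bij_betw_def)
  have "order H = order G"
    using bij_betw_same_card[OF bij] by (simp add: order_def)
  moreover have "disjoint_family_on (\<lambda>j. f ` A j) {1..m}"
    unfolding disjoint_family_on_def
  proof (intro ballI impI)
    fix i j assume ij: "i \<in> {1..m}" "j \<in> {1..m}" "i \<noteq> j"
    then have "A i \<inter> A j = {}"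
      using dis by (auto simp: disjoint_family_on_def)
    then show "f ` A i \<inter> f ` A j = {}"
      using inj_on_image_Int[OF inj sub[OF ij(1)] sub[OF ij(2)]] by simp
  qed
  moreover have "(\<Sum>i\<in>{1..m} - {j}. delta_E H (f ` A i) (f ` A j)) =
        repeat_mset l (mset_set (carrier H - {\<one>\<^bsub>H\<^esub>}))" if j: "j \<in> {1..m}" for j
  proof -
    have "(\<Sum>i\<in>{1..m} - {j}. delta_E H (f ` A i) (f ` A j))
        = (\<Sum>i\<in>{1..m} - {j}. image_mset f (delta_E G (A i) (A j)))"
      using sub j by (intro sum.cong refl delta_E_iso[OF gG gH f]) auto
    also have "\<dots> = image_mset f (\<Sum>i\<in>{1..m} - {j}. delta_E G (A i) (A j))"
      by (simp add: image_mset_sum)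
    also have "\<dots> = repeat_mset l (mset_set (f ` (carrier G - {\<one>\<^bsub>G\<^esub>})))"
      using image_mset_mset_set[OF inj_on_subset[OF inj, of "carrier G - {\<one>\<^bsub>G\<^esub>}"]]
      unfolding dif[OF j] image_mset_repeat by simp
    also have "f ` (carrier G - {\<one>\<^bsub>G\<^esub>}) = carrier H - {\<one>\<^bsub>H\<^esub>}"
      using inj_on_image_set_diff[OF inj, of "carrier G" "{\<one>\<^bsub>G\<^esub>}"] im by auto
    finally show ?thesis .
  qed
  moreover have "card (f ` A j) = card (A j)" "f ` A j \<subseteq> carrier H" if "j \<in> {1..m}" for j
    using card_image[OF inj_on_subset[OF inj sub[OF that]]] sub[OF that] im by auto
  moreover have "finite (carrier H)"
    using fin im by (metis finite_imageI)
  ultimately show ?thesis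
    using S H by (auto simp: is_sedf_def)
qed

lemma is_sedf_imp_sedf_exists:
  assumes "is_sedf G n m k l A"
  shows "sedf_exists n m k l"
proof -
  have "comm_group G" and fin: "finite (carrier G)"
    using assms by (auto simp: is_sedf_def)
  interpret comm_group G by fact
  obtain f :: "'a \<Rightarrow> nat" where inj: "inj_on f (carrier G)"
    using finite_imp_inj_to_nat_seg[OF fin] by blast
  define g where "g = the_inv_into (carrier G) f"
  have g: "\<And>x. x \<in> carrier G \<Longrightarrow> g (f x) = x"
    unfolding g_def using the_inv_into_f_f[OF inj] .
  define H :: "nat monoid" where
    "H = \<lparr>carrier = f ` carrier G, monoid.mult = (\<lambda>a b. f (g a \<otimes>\<^bsub>G\<^esub> g b)), one = f \<one>\<^bsub>G\<^esub>\<rparr>"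
  have "comm_group H"
  proof (rule comm_groupI)
    fix x assume "x \<in> carrier H"
    then obtain a where a: "a \<in> carrier G" "x = f a" by (auto simp: H_def)
    show "\<exists>y\<in>carrier H. y \<otimes>\<^bsub>H\<^esub> x = \<one>\<^bsub>H\<^esub>"
      by (rule bexI[of _ "f (inv\<^bsub>G\<^esub> a)"]) (use a in \<open>auto simp: H_def g l_inv\<close>)
  qed (auto simp: H_def g m_ac)
  moreover have "f \<in> iso G H"
    using inj by (auto simp: iso_def hom_def bij_betw_def H_def g)
  ultimately show ?thesis
    unfolding sedf_exists_def using is_sedf_iso[OF assms] by blast
qed

end

theory Submission
  imports Defs "HOL-Number_Theory.Euler_Criterion"
begin

text \<open>If \<open>q = p\<^sup>n = 1 + (4t)\<^sup>2\<close>, then \<open>n = 1\<close>: an even \<open>n\<close> gives consecutive squares, and for odd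
  \<open>n\<close> this is Lebesgue's theorem. With \<open>p = u\<^sup>2 + v\<^sup>2\<close>, \<open>u\<close> odd, uniqueness of the representation
  as a sum of two squares makes \<open>Re ((u + v i)\<^sup>n)\<close> equal to \<open>\<plusminus>1\<close>; as \<open>u\<close> divides it, \<open>u = \<plusminus>1\<close>, and
  the 2-adic valuation of \<open>Re ((1 + v i)\<^sup>n) - 1\<close> leaves only \<open>n = 1\<close>. So we may work in \<open>\<int>/p\<close>.

  There the classes \<open>C\<^sub>0\<close> and \<open>C\<^sub>2\<close> of order 4 (fourth powers, and squares that are not fourth powers)
  form the family. The number \<open>M(z)\<close> of representations of \<open>z \<noteq> 0\<close> as a difference of \<open>C\<^sub>0\<close> and
  \<open>C\<^sub>2\<close> depends only on the quadratic character \<open>\<eta>(z)\<close>, because multiplication by a square either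
  fixes or exchanges the two classes and \<open>-1\<close> is a fourth power. Its two values \<open>M\<^sub>+\<close>, \<open>M\<^sub>-\<close> have sum
  \<open>(p - 1) / 8\<close>, and their difference satisfies \<open>4 (M\<^sub>+ - M\<^sub>-) = -1 - S\<close>, where \<open>2S\<close> is the sum of
  \<open>\<eta>(x (x\<^sup>2 - 1))\<close> over \<open>x\<close>. Jacobsthal's identity \<open>p = S\<^sup>2 + V\<^sup>2\<close> compared with \<open>p = 1 + (4t)\<^sup>2\<close>
  yields \<open>S = \<plusminus>1\<close>, and \<open>S \<equiv> -1\<close> modulo 4 forces \<open>S = -1\<close>, that is \<open>M\<^sub>+ = M\<^sub>-\<close>.\<close>

subsection \<open>Prime powers of the form \<open>1 + y\<^sup>2\<close>\<close>

text \<open>The product \<open>(Y * S - V) * (Y * S + V)\<close> equals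
  \<open>p ^ n * (S^2 - 1)\<close>. If \<open>p\<close> divided both factors it would divide
  \<open>2 * Y * S\<close>, so all of \<open>p ^ n\<close> divides one of them. Brahmagupta's
  identity then leaves room for only one nonzero square.\<close>

lemma sum_two_squares_prime_power_unique:
  fixes Y S V :: int and p :: nat
  assumes p: "Factorial_Ring.prime p" "2 < p" and n: "0 < n"
    and Y: "int p ^ n = 1 + Y\<^sup>2" and SV: "int p ^ n = S\<^sup>2 + V\<^sup>2"
    and S: "\<not> int p dvd S"
  shows "S\<^sup>2 = 1 \<or> V\<^sup>2 = 1"
proof -
  have pi: "Factorial_Ring.prime (int p)" using p by simp
  \<comment> \<open>\<open>W\<close> stands for \<open>V\<close> or \<open>- V\<close>, so that one
    argument serves both factors.\<close>
  have key: "S\<^sup>2 = 1 \<or> W\<^sup>2 = 1" if W: "W\<^sup>2 = V\<^sup>2" and d: "int p ^ n dvd Y * S - W" for W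
  proof (cases "Y * S - W = 0")
    case True
    then have "W\<^sup>2 = Y\<^sup>2 * S\<^sup>2" by (simp flip: power_mult_distrib)
    then have "S\<^sup>2 * int p ^ n = 1 * int p ^ n" using Y SV W by (simp add: algebra_simps)
    then show ?thesis using p by (simp add: mult_cancel_right)
  next
    case False
    have "int p ^ n \<le> \<bar>Y * S - W\<bar>"
      using dvd_imp_le_int[OF False d] p by simp
    then have "(int p ^ n)\<^sup>2 \<le> (Y * S - W)\<^sup>2"
      by (metis abs_ge_zero abs_of_nat power2_abs power_mono of_nat_power zero_le_power2 of_nat_0_le_iff)
    moreover have "int p ^ n * int p ^ n = (1 + Y\<^sup>2) * (S\<^sup>2 + W\<^sup>2)"
      using Y SV W by simp
    then have "(int p ^ n)\<^sup>2 = (S + Y * W)\<^sup>2 + (Y * S - W)\<^sup>2"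
      by (simp add: power2_eq_square algebra_simps)
    ultimately have "(S + Y * W)\<^sup>2 \<le> 0" by linarith
    then have "S = - (Y * W)" by simp
    then have "S\<^sup>2 = Y\<^sup>2 * W\<^sup>2" by (simp add: power_mult_distrib)
    then have "W\<^sup>2 * int p ^ n = 1 * int p ^ n" using Y SV W by (simp add: algebra_simps)
    then show ?thesis using p by (simp add: mult_cancel_right)
  qed
  have "(Y * S - V) * (Y * S + V) = (1 + Y\<^sup>2) * S\<^sup>2 - (S\<^sup>2 + V\<^sup>2)"
    by (simp add: power2_eq_square algebra_simps)
  also have "\<dots> = int p ^ n * (S\<^sup>2 - 1)"
    using Y SV by (simp add: algebra_simps)
  finally have dv: "int p ^ n dvd (Y * S - V) * (Y * S + V)" by simp
  have "\<not> int p dvd Y"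
  proof
    assume "int p dvd Y"
    then have "int p dvd Y\<^sup>2" by (simp add: power2_eq_square)
    moreover have "int p dvd 1 + Y\<^sup>2" using Y n by (metis dvd_power)
    ultimately have "int p dvd 1" by (metis dvd_add_left_iff)
    then show False using p by simp
  qed
  moreover have "\<not> int p dvd 2" using p(2) zdvd_imp_le[of "int p" 2] by auto
  ultimately have "\<not> int p dvd 2 * (Y * S)"
    using S prime_dvd_mult_iff[OF pi] by blast
  moreover have "2 * (Y * S) = (Y * S - V) + (Y * S + V)" by simp
  ultimately have "\<not> int p dvd Y * S - V \<or> \<not> int p dvd Y * S + V"
    by (metis dvd_add)
  then have "coprime (int p ^ n) (Y * S - V) \<or> coprime (int p ^ n) (Y * S + V)"
    using prime_imp_coprime[OF pi] by auto
  then have "int p ^ n dvd Y * S - V \<or> int p ^ n dvd Y * S - (- V)"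
    using dv by (auto simp: coprime_dvd_mult_right_iff coprime_dvd_mult_left_iff)
  then show ?thesis using key[of V] key[of "-V"] by auto
qed

text \<open>Real and imaginary part of \<open>(u + v * i) ^ n\<close>.\<close>

fun gauss_re gauss_im :: "int \<Rightarrow> int \<Rightarrow> nat \<Rightarrow> int" where
  "gauss_re u v 0 = 1"
| "gauss_im u v 0 = 0"
| "gauss_re u v (Suc n) = u * gauss_re u v n - v * gauss_im u v n"
| "gauss_im u v (Suc n) = v * gauss_re u v n + u * gauss_im u v n"

lemma gauss_add:
  "gauss_re u v (m + n) = gauss_re u v m * gauss_re u v n - gauss_im u v m * gauss_im u v n
   \<and> gauss_im u v (m + n) = gauss_re u v m * gauss_im u v n + gauss_im u v m * gauss_re u v n"
proof (induction m)
  case (Suc m)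
  then have "gauss_re u v (m + n) = gauss_re u v m * gauss_re u v n - gauss_im u v m * gauss_im u v n"
    "gauss_im u v (m + n) = gauss_re u v m * gauss_im u v n + gauss_im u v m * gauss_re u v n"
    by auto
  then show ?case by (simp add: right_diff_distrib distrib_left left_diff_distrib distrib_right mult.assoc)
qed simp

lemma gauss_norm: "(gauss_re u v n)\<^sup>2 + (gauss_im u v n)\<^sup>2 = (u\<^sup>2 + v\<^sup>2) ^ n"
proof (induction n)
  case (Suc n)
  have "(gauss_re u v (Suc n))\<^sup>2 + (gauss_im u v (Suc n))\<^sup>2
      = (u\<^sup>2 + v\<^sup>2) * ((gauss_re u v n)\<^sup>2 + (gauss_im u v n)\<^sup>2)"
    by (simp add: power2_eq_square algebra_simps)
  then show ?case by (simp only: Suc power_Suc)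
qed simp

lemma gauss_parity: "odd u \<Longrightarrow> even v \<Longrightarrow> odd (gauss_re u v n) \<and> even (gauss_im u v n)"
  by (induction n) auto

text \<open>Modulo \<open>u\<close> the power is \<open>(v * i) ^ n\<close>, which is real for even
  \<open>n\<close> and purely imaginary for odd \<open>n\<close>.\<close>

lemma gauss_dvd: "(even n \<longrightarrow> u dvd gauss_im u v n) \<and> (odd n \<longrightarrow> u dvd gauss_re u v n)"
  by (induction n) auto

text \<open>Modulo \<open>p\<close> the real part is multiplied by \<open>2 * u\<close> from one
  power to the next, and \<open>p\<close> does not divide \<open>2 * u\<close>.\<close>

lemma gauss_re_not_dvd:
  fixes p :: nat
  assumes p: "Factorial_Ring.prime p" "2 < p" and uv: "int p = u\<^sup>2 + v\<^sup>2"
  shows "\<not> int p dvd gauss_re u v (Suc n)"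
proof -
  have pi: "Factorial_Ring.prime (int p)" using p by simp
  have not_dvd_u: "\<not> int p dvd u"
  proof
    assume u: "int p dvd u"
    then have "int p dvd u\<^sup>2" by (simp add: power2_eq_square)
    then have "int p dvd v\<^sup>2" using uv by (metis dvd_add_right_iff dvd_refl)
    then have v: "int p dvd v" using prime_dvd_power[OF pi] by blast
    have "(int p)\<^sup>2 dvd u\<^sup>2 + v\<^sup>2" using u v by (intro dvd_add dvd_power_same)
    then have "(int p)\<^sup>2 dvd int p" using uv by simp
    then have "int p * int p \<le> int p" using p by (intro zdvd_imp_le) (simp_all add: power2_eq_square)
    then show False using p by simp
  qed
  have not_dvd_2: "\<not> int p dvd 2" using p(2) zdvd_imp_le[of "int p" 2] by auto
  show ?thesis
  proof (induction n)
    case 0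
    show ?case using not_dvd_u by simp
  next
    case (Suc n)
    \<comment> \<open>For \<open>z = u + v * i\<close> of norm \<open>p\<close> this is the real
      part of \<open>z^2 = 2 * u * z - p\<close>, multiplied by a power of \<open>z\<close>.\<close>
    have "2 * u * gauss_re u v (Suc n) = gauss_re u v (Suc (Suc n)) + int p * gauss_re u v n"
      unfolding uv by (simp add: power2_eq_square algebra_simps)
    then have "int p dvd 2 * u * gauss_re u v (Suc n)" if "int p dvd gauss_re u v (Suc (Suc n))"
      using that by (metis dvd_add dvd_triv_left)
    moreover have "\<not> int p dvd 2 * u * gauss_re u v (Suc n)"
      using Suc not_dvd_u not_dvd_2 prime_dvd_mult_iff[OF pi] by blast
    ultimately show ?case by blast
  qed
qed

text \<open>Binomial expansion of \<open>(1 + v * i) ^ n\<close> to first order: for even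
  \<open>v\<close>, \<open>y\<close> has the parity of the linear coefficient
  \<open>n\<close>.\<close>

lemma gauss_1_mod:
  "\<exists>x y. gauss_re 1 v n = 1 + v\<^sup>2 * x \<and> gauss_im 1 v n = v * y \<and> (even v \<longrightarrow> (odd y \<longleftrightarrow> odd n))"
proof (induction n)
  case 0
  show ?case by (intro exI[of _ 0]) simp
next
  case (Suc n)
  then obtain x y where "gauss_re 1 v n = 1 + v\<^sup>2 * x" "gauss_im 1 v n = v * y"
    "even v \<longrightarrow> (odd y \<longleftrightarrow> odd n)" by blast
  then show ?case
    by (intro exI[of _ "x - y"] exI[of _ "y + 1 + v\<^sup>2 * x"])
      (auto simp: power2_eq_square algebra_simps)
qed

text \<open>Repeated squaring, starting from an odd exponent, gains exactly one factor 2 in the real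
  part minus 1 at each later step; the odd cofactor \<open>s\<close> records that there is no
  more.\<close>

lemma gauss_1_two_power:
  assumes v: "even v" and m: "odd m"
  shows "\<exists>s c. odd s \<and> gauss_re 1 v (2 ^ Suc e * m) = 1 + 2 ^ e * v\<^sup>2 * s
    \<and> gauss_im 1 v (2 ^ Suc e * m) = 2 ^ Suc e * v * c"
proof (induction e)
  case 0
  obtain x y where xy: "gauss_re 1 v m = 1 + v\<^sup>2 * x" "gauss_im 1 v m = v * y" "odd y"
    using gauss_1_mod[of v m] v m by blast
  show ?case
    using gauss_add[of 1 v m m] xy v
    by (intro exI[of _ "2 * x + v\<^sup>2 * x\<^sup>2 - y\<^sup>2"] exI[of _ "(1 + v\<^sup>2 * x) * y"])
      (simp add: mult_2 power2_eq_square algebra_simps)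
next
  case (Suc e)
  then obtain s c where sc: "odd s" "gauss_re 1 v (2 ^ Suc e * m) = 1 + 2 ^ e * v\<^sup>2 * s"
    "gauss_im 1 v (2 ^ Suc e * m) = 2 ^ Suc e * v * c" by blast
  define k where "k = 2 ^ Suc e * m"
  obtain w where w: "v = 2 * w" using v by blast
  have k: "2 ^ Suc (Suc e) * m = k + k" by (simp add: k_def)
  have "gauss_re 1 v (k + k) = (1 + 2 ^ e * v\<^sup>2 * s)\<^sup>2 - (2 ^ Suc e * v * c)\<^sup>2"
    using gauss_add[of 1 v k k] sc(2,3)[folded k_def] by (simp only: power2_eq_square)
  \<comment> \<open>Writing \<open>v = 2 * w\<close> supplies the extra factor 2 in the term
    quadratic in \<open>s\<close>, so the new cofactor is \<open>s\<close> plus an even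
    number.\<close>
  also have "\<dots> = 1 + 2 ^ Suc e * v\<^sup>2 * (s + 2 * (2 ^ e * w\<^sup>2 * s\<^sup>2 - 2 ^ e * c\<^sup>2))"
    unfolding w by (simp add: power2_eq_square algebra_simps)
  finally have re: "gauss_re 1 v (2 ^ Suc (Suc e) * m) = \<dots>" by (simp only: k)
  have "gauss_im 1 v (k + k) = 2 * ((1 + 2 ^ e * v\<^sup>2 * s) * (2 ^ Suc e * v * c))"
    using gauss_add[of 1 v k k] sc(2,3)[folded k_def] by (simp only: mult.commute mult_2)
  also have "\<dots> = 2 ^ Suc (Suc e) * v * ((1 + 2 ^ e * v\<^sup>2 * s) * c)"
    by simp
  finally have im: "gauss_im 1 v (2 ^ Suc (Suc e) * m) = \<dots>" by (simp only: k)
  have "odd (s + 2 * (2 ^ e * w\<^sup>2 * s\<^sup>2 - 2 ^ e * c\<^sup>2))" using sc(1) by simp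
  with re im show ?case by blast
qed

text \<open>Write \<open>n - 1\<close> as \<open>2 ^ Suc e * m\<close> with \<open>m\<close> odd.
  One more factor \<open>1 + v * i\<close> turns the cofactor \<open>s\<close> into
  \<open>s - 2 * c\<close>, which is odd and hence nonzero; this excludes the value 1, and the value
  -1 fails modulo 4.\<close>

lemma gauss_re_1_ne:
  assumes v: "even v" "v \<noteq> 0" and n: "odd n" "1 < n"
  shows "(gauss_re 1 v n)\<^sup>2 \<noteq> 1"
proof -
  have "n - 1 \<noteq> 0" "even (n - 1)" using n by auto
  obtain m where m: "n - 1 = 2 ^ multiplicity 2 (n - 1) * m" "odd m"
    using multiplicity_decompose'[OF \<open>n - 1 \<noteq> 0\<close>, of 2] by auto
  then obtain f where f: "n - 1 = 2 ^ f * m" "odd m" by blast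
  have "f \<noteq> 0"
  proof
    assume "f = 0"
    then show False using f \<open>even (n - 1)\<close> by simp
  qed
  then obtain e where e: "n = Suc (2 ^ Suc e * m)" 
  proof -
    obtain e where "f = Suc e" using \<open>f \<noteq> 0\<close> not0_implies_Suc by blast
    moreover have "n = Suc (n - 1)" using n by simp
    ultimately show ?thesis using that[of e] f(1) by metis
  qed
  obtain s c where sc: "odd s" "gauss_re 1 v (2 ^ Suc e * m) = 1 + 2 ^ e * v\<^sup>2 * s"
    "gauss_im 1 v (2 ^ Suc e * m) = 2 ^ Suc e * v * c"
    using gauss_1_two_power[OF v(1) f(2)] by blast
  have g: "gauss_re 1 v n = 1 + 2 ^ e * v\<^sup>2 * (s - 2 * c)"
    unfolding e gauss_re.simps sc by (simp add: power2_eq_square algebra_simps)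
  have "s - 2 * c \<noteq> 0" using sc(1) by auto
  then have "gauss_re 1 v n \<noteq> 1" using g v by simp
  moreover have "gauss_re 1 v n \<noteq> - 1"
  proof
    assume *: "gauss_re 1 v n = - 1"
    obtain w where "v = 2 * w" using v by blast
    then have "2 * (2 * (2 ^ e * w\<^sup>2 * (s - 2 * c))) = - 2"
      using g * by (simp add: power2_eq_square algebra_simps)
    then have "2 * (2 ^ e * w\<^sup>2 * (s - 2 * c)) = - 1" by linarith
    then show False by presburger
  qed
  ultimately show ?thesis by (simp add: power2_eq_1_iff)
qed

text \<open>A special case of Lebesgue's theorem on \<open>x\<^sup>2 + 1 = y\<^sup>n\<close>.\<close>

lemma prime_power_eq_square_plus_1:
  fixes p :: nat and Y u v :: int
  assumes p: "Factorial_Ring.prime p" "2 < p" and uv: "int p = u\<^sup>2 + v\<^sup>2"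
    and n: "odd n" and Y: "int p ^ n = 1 + Y\<^sup>2"
  shows "n = 1"
proof (rule ccontr)
  assume n1: "n \<noteq> 1"
  have "odd (int p)" using p prime_odd_nat by simp
  then have "odd (u\<^sup>2 + v\<^sup>2)" using uv by simp
  \<comment> \<open>Exchanging \<open>u\<close> and \<open>v\<close> and taking absolute values
    makes the real part odd and nonnegative.\<close>
  then obtain a b where ab: "int p = a\<^sup>2 + b\<^sup>2" "odd a" "even b" "0 \<le> a"
  proof (cases "odd u")
    case True
    then show ?thesis using that[of "\<bar>u\<bar>" v] uv \<open>odd (u\<^sup>2 + v\<^sup>2)\<close> by auto
  next
    case False
    then show ?thesis using that[of "\<bar>v\<bar>" u] uv \<open>odd (u\<^sup>2 + v\<^sup>2)\<close> by (auto simp: add.commute)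
  qed
  obtain k where k: "n = Suc k" using n by (cases n) auto
  have "\<not> int p dvd gauss_re a b n"
    unfolding k by (rule gauss_re_not_dvd[OF p ab(1)])
  then have "(gauss_re a b n)\<^sup>2 = 1 \<or> (gauss_im a b n)\<^sup>2 = 1"
    using sum_two_squares_prime_power_unique[OF p _ Y] gauss_norm[of a b n] ab(1) k by simp
  \<comment> \<open>The imaginary part is even, so its square cannot be 1.\<close>
  then have 1: "(gauss_re a b n)\<^sup>2 = 1"
    using gauss_parity[OF ab(2,3), of n] by (auto simp: power2_eq_1_iff)
  have "a dvd gauss_re a b n" using gauss_dvd n by blast
  then have "a dvd 1" using 1 by (metis dvd_trans dvd_triv_left power2_eq_square)
  then have a: "a = 1" using ab(4) by simp
  then have "b \<noteq> 0" using ab(1) p by auto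
  then show False using gauss_re_1_ne[OF ab(3) _ n] n n1 1 a k by simp
qed

subsection \<open>Quadratic character sums modulo a prime\<close>

locale odd_prime =
  fixes p :: nat
  assumes prime: "Factorial_Ring.prime p" and gt_2: "2 < p"
begin

abbreviation residues_p :: "int set" ("R") where "R \<equiv> {0..<int p}"

text \<open>Functions on Z/p are encoded as functions on all integers, so that substitutions in sums
  over \<open>R\<close> need no explicit reduction modulo \<open>p\<close>.\<close>

definition periodic :: "(int \<Rightarrow> 'a) \<Rightarrow> bool" where
  "periodic f \<longleftrightarrow> (\<forall>x y. [x = y] (mod int p) \<longrightarrow> f x = f y)"

definition eta :: "int \<Rightarrow> int" where "eta a = Legendre a (int p)"

section \<open>Sums of periodic functions over the residues\<close>

lemma periodicD: "periodic f \<Longrightarrow> [x = y] (mod int p) \<Longrightarrow> f x = f y"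
  by (auto simp: periodic_def)

lemma prime_int: "Factorial_Ring.prime (int p)"
  using prime by simp

lemma p_pos: "0 < int p"
  using gt_2 by simp

lemma mod_in_R: "x mod int p \<in> R"
  using p_pos by simp

lemma cong_mod_p: "[x mod int p = x] (mod int p)"
  by simp

lemma cong_R_iff: "x \<in> R \<Longrightarrow> y \<in> R \<Longrightarrow> [x = y] (mod int p) \<longleftrightarrow> x = y"
  by (auto simp: cong_def)

text \<open>An affine map with unit slope permutes the residues, and periodicity absorbs the
  reduction back into \<open>R\<close>.\<close>

lemma sum_affine:
  fixes f :: "int \<Rightarrow> int"
  assumes f: "periodic f" and c: "\<not> int p dvd c"
  shows "(\<Sum>x\<in>R. f (c * x + d)) = (\<Sum>x\<in>R. f x)"
proof -
  let ?h = "\<lambda>x. (c * x + d) mod int p"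
  have "inj_on ?h R"
  proof (rule inj_onI)
    fix x y assume xy: "x \<in> R" "y \<in> R" and "?h x = ?h y"
    then have "[c * x + d = c * y + d] (mod int p)" by (simp add: cong_def)
    then have "int p dvd c * (x - y)"
      by (simp add: cong_iff_dvd_diff right_diff_distrib)
    then have "int p dvd x - y"
      using c prime_int prime_dvd_mult_iff by blast
    then show "x = y"
      using xy cong_R_iff by (simp add: cong_iff_dvd_diff)
  qed
  moreover have "?h ` R \<subseteq> R"
    using mod_in_R by blast
  ultimately have "bij_betw ?h R R"
    by (simp add: bij_betw_def endo_inj_surj)
  then have "(\<Sum>x\<in>R. f (?h x)) = (\<Sum>x\<in>R. f x)"
    by (rule sum.reindex_bij_betw)
  moreover have "f (?h x) = f (c * x + d)" for x
    by (rule periodicD[OF f cong_mod_p])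
  ultimately show ?thesis by simp
qed

lemma not_dvd_1: "\<not> int p dvd 1"
  using gt_2 by (auto simp: zdvd1_eq)

lemma not_dvd_2: "\<not> int p dvd 2"
  using gt_2 zdvd_imp_le by fastforce

lemma sum_scale:
  fixes f :: "int \<Rightarrow> int"
  shows "periodic f \<Longrightarrow> \<not> int p dvd c \<Longrightarrow> (\<Sum>x\<in>R. f (c * x)) = (\<Sum>x\<in>R. f x)"
  using sum_affine[of f c 0] by simp

lemma sum_shift:
  fixes f :: "int \<Rightarrow> int"
  shows "periodic f \<Longrightarrow> (\<Sum>x\<in>R. f (x + d)) = (\<Sum>x\<in>R. f x)"
  using sum_affine[of f 1 d] not_dvd_1 by simp

lemma sum_delta_cong:
  fixes f :: "int \<Rightarrow> int"
  assumes f: "periodic f"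
  shows "(\<Sum>x\<in>R. if [a = x] (mod int p) then f x else 0) = f a"
proof -
  have "[a = x] (mod int p) \<longleftrightarrow> x = a mod int p" if "x \<in> R" for x
    using that by (auto simp: cong_def)
  then have "(\<Sum>x\<in>R. if [a = x] (mod int p) then f x else 0)
      = (\<Sum>x\<in>R. if x = a mod int p then f x else 0)"
    by (intro sum.cong) auto
  also have "\<dots> = f (a mod int p)"
    using mod_in_R by simp
  finally show ?thesis
    using periodicD[OF f cong_mod_p] by simp
qed

lemma cong_square_iff: "[x\<^sup>2 = y\<^sup>2] (mod int p) \<longleftrightarrow> [x = y] (mod int p) \<or> [- x = y] (mod int p)"
proof -
  have "x\<^sup>2 - y\<^sup>2 = (x - y) * (x + y)"
    by (simp add: power2_eq_square algebra_simps)
  moreover have "int p dvd x + y \<longleftrightarrow> int p dvd - x - y"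
    by (metis dvd_minus_iff minus_add_distrib uminus_add_conv_diff add.commute)
  ultimately show ?thesis
    using prime_dvd_mult_iff[OF prime_int] by (simp add: cong_iff_dvd_diff)
qed

text \<open>As \<open>p\<close> is odd, \<open>x\<close> and \<open>- x\<close> are two different
  residues, and they are the only square roots of \<open>x^2\<close>.\<close>

lemma sum_square_fibre:
  fixes f :: "int \<Rightarrow> int"
  assumes f: "periodic f" and x: "\<not> int p dvd x"
  shows "(\<Sum>y\<in>R. if [x\<^sup>2 = y\<^sup>2] (mod int p) then f y else 0) = f x + f (- x)"
proof -
  have "\<not> ([x = y] (mod int p) \<and> [- x = y] (mod int p))" for y
  proof
    assume "[x = y] (mod int p) \<and> [- x = y] (mod int p)"
    then have "[x = - x] (mod int p)" by (metis cong_sym cong_trans)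
    then have "int p dvd 2 * x" by (simp add: cong_iff_dvd_diff)
    then show False using x not_dvd_2 prime_dvd_mult_iff[OF prime_int] by blast
  qed
  then have "(\<Sum>y\<in>R. if [x\<^sup>2 = y\<^sup>2] (mod int p) then f y else 0)
     = (\<Sum>y\<in>R. (if [x = y] (mod int p) then f y else 0) + (if [- x = y] (mod int p) then f y else 0))"
    unfolding cong_square_iff by (intro sum.cong) auto
  also have "\<dots> = f x + f (- x)"
    by (simp only: sum.distrib sum_delta_cong[OF f])
  finally show ?thesis .
qed

section \<open>The quadratic character and its sums\<close>

lemma eta_periodic: "periodic eta"
proof -
  have "eta x = eta y" if "[x = y] (mod int p)" for x y
    using that by (simp add: eta_def Legendre_def QuadRes_def cong_def)
  then show ?thesis by (auto simp: periodic_def)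
qed

lemma periodic_comp:
  assumes "periodic f" and "\<And>x y. [x = y] (mod int p) \<Longrightarrow> [g x = g y] (mod int p)"
  shows "periodic (\<lambda>x. f (g x))"
  using assms by (auto simp: periodic_def)

lemma eta_values: "eta a \<in> {-1, 0, 1}"
  by (auto simp: eta_def Legendre_def)

lemma eta_eq_0_iff: "eta a = 0 \<longleftrightarrow> int p dvd a"
  by (auto simp: eta_def Legendre_def cong_iff_dvd_diff)

text \<open>Euler's criterion gives the congruence modulo \<open>p\<close>; both sides lie in {-1,
  0, 1}, so their distance is at most 2, which is less than \<open>p\<close>.\<close>

lemma eta_mult: "eta (a * b) = eta a * eta b"
proof -
  let ?e = "(p - 1) div 2"
  have E: "[eta c = c ^ ?e] (mod int p)" for c
    unfolding eta_def using euler_criterion[OF prime gt_2] by simp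
  have "[eta (a * b) = a ^ ?e * b ^ ?e] (mod int p)"
    using E[of "a * b"] by (simp add: power_mult_distrib)
  moreover have "[eta a * eta b = a ^ ?e * b ^ ?e] (mod int p)"
    by (intro cong_mult E)
  ultimately have "[eta (a * b) = eta a * eta b] (mod int p)"
    by (metis cong_sym cong_trans)
  then have d: "int p dvd eta (a * b) - eta a * eta b"
    by (simp add: cong_iff_dvd_diff)
  have "\<bar>eta (a * b) - eta a * eta b\<bar> \<le> 2"
    using eta_values[of a] eta_values[of b] eta_values[of "a * b"] by auto
  then show ?thesis
    using d gt_2 dvd_imp_le_int[OF _ d] by fastforce
qed

lemma eta_square: "\<not> int p dvd a \<Longrightarrow> eta (a\<^sup>2) = 1"
  using eta_mult[of a a] eta_values[of a] eta_eq_0_iff[of a] by (auto simp: power2_eq_square)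

lemma eta_1: "eta 1 = 1"
  using eta_square[of 1] not_dvd_1 by simp

lemma eta_eq_1E:
  assumes "eta a = 1"
  obtains c where "[c\<^sup>2 = a] (mod int p)" "\<not> int p dvd c"
proof -
  obtain c where c: "[c\<^sup>2 = a] (mod int p)"
    using assms by (auto simp: eta_def Legendre_def QuadRes_def split: if_splits)
  have "eta (c\<^sup>2) = 1" using periodicD[OF eta_periodic c] assms by simp
  then have "\<not> int p dvd c" using eta_eq_0_iff[of "c\<^sup>2"] by (auto simp: power2_eq_square)
  with c show ?thesis using that by blast
qed

lemma sum_R_split_0: "(\<Sum>x\<in>R. f x) = f 0 + (\<Sum>x\<in>R - {0}. f x)" for f :: "int \<Rightarrow> int"
  using p_pos by (subst sum.remove[of _ 0]) auto

lemma in_R_dvd: "x \<in> R \<Longrightarrow> int p dvd x \<longleftrightarrow> x = 0"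
  using zdvd_not_zless[of x "int p"] by force

lemma sum_eta_squared: "(\<Sum>x\<in>R. (eta x)\<^sup>2) = int p - 1"
proof -
  have "(eta x)\<^sup>2 = 1" if "x \<in> R - {0}" for x
    using that eta_values[of x] eta_eq_0_iff[of x] in_R_dvd[of x] by auto
  then have "(\<Sum>x\<in>R - {0}. (eta x)\<^sup>2) = int (card (R - {0}))" by simp
  also have "\<dots> = int p - 1" using p_pos by (simp add: card_Diff_singleton)
  finally show ?thesis using sum_R_split_0[of "\<lambda>x. (eta x)\<^sup>2"] eta_eq_0_iff[of 0] by simp
qed

lemma periodic_eta: "periodic (\<lambda>x. eta (g x))" if "\<And>x y. [x = y] (mod int p) \<Longrightarrow> [g x = g y] (mod int p)"
  using periodic_comp[OF eta_periodic that] .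

text \<open>If every unit were a square, squaring would permute the residues, but \<open>1\<close> and \<open>-1\<close> have
  the same square.\<close>

lemma non_residueE: obtains g where "eta g = -1"
proof (rule ccontr)
  assume "\<not> thesis"
  then have *: "eta a \<noteq> -1" for a using that by blast
  let ?h = "\<lambda>x. x\<^sup>2 mod int p"
  have "R \<subseteq> ?h ` R"
  proof
    fix a assume a: "a \<in> R"
    show "a \<in> ?h ` R"
    proof (cases "a = 0")
      case False
      then have "eta a = 1" using *[of a] eta_values[of a] eta_eq_0_iff in_R_dvd a by auto
      then obtain c where "[c\<^sup>2 = a] (mod int p)" by (rule eta_eq_1E)
      then have "?h (c mod int p) = a" using a by (simp add: cong_def power_mod)
      then show ?thesis using mod_in_R by force
    qed (use p_pos in \<open>auto intro!: image_eqI[of _ _ 0]\<close>)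
  qed
  then have "inj_on ?h R" by (intro finite_surj_inj) auto
  moreover have "?h 1 = ?h (int p - 1)"
    by (metis cong_def cong_square_iff cong_iff_dvd_diff diff_minus_eq_add add.commute diff_add_cancel dvd_refl
     minus_diff_eq minus_dvd_iff uminus_add_conv_diff)
  moreover have "1 \<in> R" "int p - 1 \<in> R" using gt_2 by auto
  ultimately have "1 = int p - 1" by (rule inj_onD)
  then show False using gt_2 by simp
qed

lemma sum_eta: "(\<Sum>x\<in>R. eta x) = 0"
proof -
  obtain g where g: "eta g = -1" by (rule non_residueE)
  then have "\<not> int p dvd g" using eta_eq_0_iff[of g] by simp
  then have "(\<Sum>x\<in>R. eta x) = (\<Sum>x\<in>R. eta (g * x))"
    using sum_scale[OF eta_periodic] by simp
  also have "\<dots> = - (\<Sum>x\<in>R. eta x)" by (simp add: eta_mult g sum_negf)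
  finally show ?thesis by simp
qed

text \<open>The sum depends only on \<open>d = c - b\<close>. Scaling \<open>x\<close> by a unit
  \<open>d\<close> shows that it has the same value for all units, and summing over all
  \<open>d\<close> gives 0, so the value at \<open>d = 0\<close> determines the other.\<close>

lemma sum_eta_two_shifts:
  "(\<Sum>x\<in>R. eta ((x + b) * (x + c))) = (if [b = c] (mod int p) then int p - 1 else -1)"
proof -
  define F where "F d = (\<Sum>x\<in>R. eta (x * (x + d)))" for d
  have per: "periodic (\<lambda>x. eta (x * (x + d)))" for d
    by (intro periodic_eta cong_mult cong_add cong_refl)
  have perF: "periodic F"
    unfolding periodic_def F_def
    by (intro allI impI sum.cong[OF refl] periodicD[OF eta_periodic] cong_mult cong_add cong_refl)
  have F0: "F 0 = int p - 1"
    unfolding F_def using sum_eta_squared by (simp add: eta_mult power2_eq_square)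
  have F1: "F d = F 1" if "\<not> int p dvd d" for d
  proof -
    have "F d = (\<Sum>x\<in>R. eta (d * x * (d * x + d)))"
      unfolding F_def using sum_scale[OF per that] by simp
    also have "\<dots> = (\<Sum>x\<in>R. eta (d\<^sup>2 * (x * (x + 1))))"
      by (simp add: algebra_simps power2_eq_square)
    also have "\<dots> = F 1" by (simp add: F_def eta_mult[of "d\<^sup>2"] eta_square that)
    finally show ?thesis .
  qed
  have "(\<Sum>d\<in>R. F d) = (\<Sum>x\<in>R. \<Sum>d\<in>R. eta x * eta (d + x))"
    unfolding F_def by (subst sum.swap) (simp add: eta_mult add.commute)
  also have "\<dots> = 0"
    by (simp add: sum_shift[OF eta_periodic] sum_eta flip: sum_distrib_left)
  finally have "F 0 + (\<Sum>d\<in>R - {0}. F d) = 0" by (simp flip: sum_R_split_0)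
  moreover have "(\<Sum>d\<in>R - {0}. F d) = (\<Sum>d\<in>R - {0}. F 1)"
  proof (rule sum.cong[OF refl])
    fix d assume "d \<in> R - {0}"
    then have "\<not> int p dvd d" using in_R_dvd by blast
    then show "F d = F 1" by (rule F1)
  qed
  ultimately have "(int p - 1) * (1 + F 1) = 0"
    using F0 p_pos by (simp add: card_Diff_singleton algebra_simps)
  then have "F 1 = -1" using gt_2 by auto
  have "(\<Sum>x\<in>R. eta ((x + b) * (x + c))) = (\<Sum>x\<in>R. eta ((x - b + b) * (x - b + c)))"
    using sum_shift[of "\<lambda>x. eta ((x + b) * (x + c))" "-b"]
    by (simp add: periodic_eta cong_mult cong_add)
  also have "\<dots> = F (c - b)" by (simp add: F_def algebra_simps)
  finally have *: "(\<Sum>x\<in>R. eta ((x + b) * (x + c))) = F (c - b)" .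
  have "int p dvd c - b \<longleftrightarrow> [b = c] (mod int p)"
    by (metis cong_iff_dvd_diff cong_sym_eq)
  moreover have "F (c - b) = F 0" if "int p dvd c - b"
    using that by (intro periodicD[OF perF]) (simp add: cong_iff_dvd_diff)
  ultimately show ?thesis using * F0 F1[of "c - b"] \<open>F 1 = -1\<close> by auto
qed

section \<open>Jacobsthal sums\<close>

definition phi :: "int \<Rightarrow> int" where "phi a = (\<Sum>x\<in>R. eta (x * (x\<^sup>2 + a)))"

lemma phi_periodic: "periodic phi"
  unfolding periodic_def phi_def
  by (intro allI impI sum.cong[OF refl] periodicD[OF eta_periodic] cong_mult cong_add cong_refl)

lemma phi_scale: assumes c: "\<not> int p dvd c" shows "phi (c\<^sup>2 * a) = eta c * phi a"
proof -
  have per: "periodic (\<lambda>x. eta (x * (x\<^sup>2 + c\<^sup>2 * a)))"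
    by (intro periodic_eta cong_mult cong_add cong_pow cong_refl)
  have "phi (c\<^sup>2 * a) = (\<Sum>x\<in>R. eta (c * x * ((c * x)\<^sup>2 + c\<^sup>2 * a)))"
    unfolding phi_def using sum_scale[OF per c] by simp
  also have "\<dots> = (\<Sum>x\<in>R. eta (c\<^sup>2 * (c * (x * (x\<^sup>2 + a)))))"
    by (simp add: algebra_simps power2_eq_square)
  also have "\<dots> = eta c * phi a"
    by (simp add: eta_mult[of "c\<^sup>2"] eta_mult[of c] eta_square[OF c] phi_def sum_distrib_left)
  finally show ?thesis .
qed

lemma phi_0: "phi 0 = 0"
proof -
  have "eta (x * x\<^sup>2) = eta x" for x
    using eta_values[of x] by (auto simp: eta_mult power2_eq_square)
  then show ?thesis by (simp add: phi_def sum_eta)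
qed

lemma count_eta_eq:
  assumes "e \<in> {-1, 1}"
  shows "(\<Sum>x\<in>R. if eta x = e then 1 else 0) * 2 = int p - 1"
proof -
  have "2 * (if eta x = e then 1 else 0) = (eta x)\<^sup>2 + e * eta x" for x
    using assms eta_values[of x] by auto
  then have "2 * (\<Sum>x\<in>R. if eta x = e then 1 else 0) = (\<Sum>x\<in>R. (eta x)\<^sup>2 + e * eta x)"
    unfolding sum_distrib_left by simp
  also have "\<dots> = int p - 1"
    by (simp add: sum.distrib sum_eta_squared sum_eta flip: sum_distrib_left)
  finally show "(\<Sum>x\<in>R. if eta x = e then 1 else 0) * 2 = int p - 1" by simp
qed

text \<open>Units of equal character differ by a square factor modulo \<open>p\<close>, so
  \<open>f\<close> has one value on the squares and one on the nonsquares among them, and each kind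
  has \<open>(p - 1) / 2\<close> residues.\<close>

lemma sum_class_function:
  fixes f :: "int \<Rightarrow> int"
  assumes f: "\<And>x c. \<not> int p dvd c \<Longrightarrow> f (c\<^sup>2 * x) = f x" and per: "periodic f"
    and a: "eta a = 1" and b: "eta b = -1"
  shows "2 * (\<Sum>x\<in>R. f x) = 2 * f 0 + (int p - 1) * (f a + f b)"
    and "2 * (\<Sum>x\<in>R. eta x * f x) = (int p - 1) * (f a - f b)"
    and "\<not> int p dvd x \<Longrightarrow> f x = (if eta x = 1 then f a else f b)"
proof -
  have eq: "f x = f y" if "eta x = eta y" "\<not> int p dvd y" for x y
  proof -
    have "eta (x * y) = 1" using that eta_values[of y] eta_eq_0_iff[of y] by (auto simp: eta_mult)
    then obtain c where c: "[c\<^sup>2 = x * y] (mod int p)" "\<not> int p dvd c" by (rule eta_eq_1E)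
    \<comment> \<open>From \<open>x * y\<close> congruent to \<open>c^2\<close> it follows that
      \<open>y^2 * x\<close> is congruent to \<open>c^2 * y\<close>.\<close>
    have "f x = f (y\<^sup>2 * x)" using f[OF that(2)] by simp
    also have "\<dots> = f (c\<^sup>2 * y)"
      using cong_mult[OF c(1) cong_refl, of y]
      by (intro periodicD[OF per]) (simp add: cong_sym_eq power2_eq_square algebra_simps)
    also have "\<dots> = f y" using f c(2) by simp
    finally show ?thesis .
  qed
  have ab: "\<not> int p dvd a" "\<not> int p dvd b" using a b eta_eq_0_iff[of a] eta_eq_0_iff[of b] by simp_all
  show cl: "f x = (if eta x = 1 then f a else f b)" if "\<not> int p dvd x" for x
  proof (cases "eta x = 1")
    case True
    then show ?thesis using eq[of x a] ab(1) a by simp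
  next
    case False
    then have "eta x = -1" using eta_values[of x] eta_eq_0_iff[of x] that by simp
    then show ?thesis using eq[of x b] ab(2) b by simp
  qed
  let ?i = "\<lambda>e x. if eta x = e then 1 else (0 :: int)"
  have nz: "f x = f a * ?i 1 x + f b * ?i (-1) x" "eta x * f x = f a * ?i 1 x - f b * ?i (-1) x"
    if "x \<in> R - {0}" for x
    using that cl[of x] in_R_dvd[of x] eta_values[of x] eta_eq_0_iff[of x] by auto
  have eta0: "eta 0 = 0" by (simp add: eta_eq_0_iff)
  have I: "2 * (\<Sum>x\<in>R - {0}. ?i e x) = int p - 1" if "e \<in> {-1, 1}" for e
    using count_eta_eq[OF that] sum_R_split_0[of "?i e"] eta0 that by auto
  have I1: "2 * (\<Sum>x\<in>R - {0}. ?i 1 x) = int p - 1" "2 * (\<Sum>x\<in>R - {0}. ?i (-1) x) = int p - 1"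
    by (rule I; simp)+
  let ?S = "\<lambda>e. \<Sum>x\<in>R - {0}. ?i e x"
  have "(\<Sum>x\<in>R. f x) = f 0 + (\<Sum>x\<in>R - {0}. f a * ?i 1 x + f b * ?i (-1) x)"
    unfolding sum_R_split_0[of f] by (simp only: sum.cong[OF refl nz(1)])
  also have "\<dots> = f 0 + (f a * ?S 1 + f b * ?S (-1))"
    by (simp only: sum.distrib sum_distrib_left)
  finally have "2 * (\<Sum>x\<in>R. f x) = 2 * f 0 + (f a * (2 * ?S 1) + f b * (2 * ?S (-1)))"
    by (simp only: algebra_simps)
  then show "2 * (\<Sum>x\<in>R. f x) = 2 * f 0 + (int p - 1) * (f a + f b)"
    unfolding I1 by (simp only: algebra_simps)
  have "(\<Sum>x\<in>R. eta x * f x) = (\<Sum>x\<in>R - {0}. f a * ?i 1 x - f b * ?i (-1) x)"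
    unfolding sum_R_split_0[of "\<lambda>x. eta x * f x"] eta0
    by (simp only: sum.cong[OF refl nz(2)] mult_zero_left add_0)
  also have "\<dots> = f a * ?S 1 - f b * ?S (-1)"
    by (simp only: sum_subtractf sum_distrib_left)
  finally have "2 * (\<Sum>x\<in>R. eta x * f x) = f a * (2 * ?S 1) - f b * (2 * ?S (-1))"
    by (simp only: algebra_simps)
  then show "2 * (\<Sum>x\<in>R. eta x * f x) = (int p - 1) * (f a - f b)"
    unfolding I1 by (simp only: algebra_simps)
qed

lemma eta_minus_1: "p mod 4 = 1 \<Longrightarrow> eta (-1) = 1"
proof -
  assume "p mod 4 = 1"
  then have "even ((p - 1) div 2)" by presburger
  then have "[eta (-1) = 1] (mod int p)"
    using euler_criterion[OF prime gt_2, of "-1"] by (simp add: eta_def)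
  then have d: "int p dvd eta (-1) - 1" by (simp add: cong_iff_dvd_diff)
  have "\<bar>eta (-1) - 1\<bar> \<le> 2" using eta_values[of "-1"] by auto
  then show ?thesis using dvd_imp_le_int[OF _ d] gt_2 by fastforce
qed

lemma eta_uminus: "p mod 4 = 1 \<Longrightarrow> eta (- a) = eta a"
  using eta_mult[of "-1" a] eta_minus_1 by simp

text \<open>The second moment of \<open>phi\<close> is computed in two ways: by expanding the square
  and summing over the parameter first, and by using that \<open>phi^2\<close> vanishes at 0 and
  depends only on the quadratic character elsewhere.\<close>

lemma jacobsthal:
  assumes p4: "p mod 4 = 1" and a: "eta a = 1" and b: "eta b = -1"
  shows "(phi a)\<^sup>2 + (phi b)\<^sup>2 = 4 * int p"
proof -
  have inner: "(\<Sum>y\<in>R. eta (x * y) * (\<Sum>c\<in>R. eta ((c + x\<^sup>2) * (c + y\<^sup>2)))) = 2 * int p * (eta x)\<^sup>2" for x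
  proof (cases "int p dvd x")
    case True
    then show ?thesis by (simp add: eta_mult eta_eq_0_iff[THEN iffD2])
  next
    case False
    have per: "periodic (\<lambda>y. eta (x * y))"
      by (intro periodic_eta cong_mult cong_refl)
    \<comment> \<open>The inner sum is \<open>p - 1\<close> or \<open>-1\<close>: the part
      \<open>p\<close> survives only at \<open>y = x\<close> and \<open>y = - x\<close>, and the
      constant \<open>-1\<close> contributes a vanishing character sum.\<close>
    have "(\<Sum>y\<in>R. eta (x * y) * (\<Sum>c\<in>R. eta ((c + x\<^sup>2) * (c + y\<^sup>2))))
       = (\<Sum>y\<in>R. int p * (if [x\<^sup>2 = y\<^sup>2] (mod int p) then eta (x * y) else 0) - eta x * eta y)"
      unfolding sum_eta_two_shifts by (intro sum.cong) (auto simp: eta_mult algebra_simps)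
    also have "\<dots> = int p * (eta (x * x) + eta (x * - x)) - eta x * 0"
      unfolding sum_subtractf sum_distrib_left[symmetric] sum_square_fibre[OF per False] sum_eta ..
    also have "\<dots> = 2 * int p * (eta x)\<^sup>2"
      using eta_uminus[OF p4, of "x * x"] by (simp add: eta_mult power2_eq_square)
    finally show ?thesis .
  qed
  have "(\<Sum>c\<in>R. (phi c)\<^sup>2)
      = (\<Sum>c\<in>R. \<Sum>x\<in>R. \<Sum>y\<in>R. eta (x * y) * eta ((c + x\<^sup>2) * (c + y\<^sup>2)))"
    unfolding phi_def power2_eq_square sum_product
    by (intro sum.cong refl) (simp add: eta_mult ac_simps)
  also have "\<dots> = (\<Sum>x\<in>R. \<Sum>c\<in>R. \<Sum>y\<in>R. eta (x * y) * eta ((c + x\<^sup>2) * (c + y\<^sup>2)))"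
    by (rule sum.swap)
  also have "\<dots> = (\<Sum>x\<in>R. \<Sum>y\<in>R. \<Sum>c\<in>R. eta (x * y) * eta ((c + x\<^sup>2) * (c + y\<^sup>2)))"
    by (intro sum.cong refl sum.swap)
  also have "\<dots> = 2 * int p * (\<Sum>x\<in>R. (eta x)\<^sup>2)"
    by (simp only: inner flip: sum_distrib_left)
  finally have total: "(\<Sum>c\<in>R. (phi c)\<^sup>2) = 2 * int p * (int p - 1)"
    by (simp only: sum_eta_squared)
  have sc: "(phi (c\<^sup>2 * x))\<^sup>2 = (phi x)\<^sup>2" if "\<not> int p dvd c" for c x
  proof -
    have "(eta c)\<^sup>2 = 1" using eta_square[OF that] by (simp add: eta_mult power2_eq_square)
    then show ?thesis by (simp add: phi_scale[OF that] power_mult_distrib)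
  qed
  have per: "periodic (\<lambda>x. (phi x)\<^sup>2)"
    using phi_periodic by (auto simp: periodic_def)
  have "2 * (2 * int p * (int p - 1)) = (int p - 1) * ((phi a)\<^sup>2 + (phi b)\<^sup>2)"
    using sum_class_function(1)[of "\<lambda>x. (phi x)\<^sup>2", OF sc per a b] total by (simp add: phi_0)
  then have "(int p - 1) * (4 * int p) = (int p - 1) * ((phi a)\<^sup>2 + (phi b)\<^sup>2)"
    by (simp add: algebra_simps)
  then show ?thesis using gt_2 by simp
qed

text \<open>If two squares have a sum divisible by 4, both bases are even, so Jacobsthal's identity
  can be divided by 4. This also writes \<open>p\<close> as a sum of two squares.\<close>

lemma phi_half:
  assumes p4: "p mod 4 = 1" and b: "eta b = -1"
  obtains S V where "phi (-1) = 2 * S" "phi b = 2 * V" "int p = S\<^sup>2 + V\<^sup>2"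
proof -
  have J: "(phi (-1))\<^sup>2 + (phi b)\<^sup>2 = 4 * int p"
    using jacobsthal[OF p4 eta_minus_1[OF p4] b] .
  have "even x \<and> even y" if "x\<^sup>2 + y\<^sup>2 = 4 * z" for x y z :: int
  proof -
    have "x\<^sup>2 mod 4 = (if even x then 0 else 1)" for x :: int
    proof (cases "even x")
      case False
      then obtain b where "x = 2 * b + 1" by (rule oddE)
      then have "x\<^sup>2 = 1 + 4 * (b + b * b)" by (simp add: power2_eq_square algebra_simps)
      then have "x\<^sup>2 mod 4 = 1" by presburger
      then show ?thesis using False by simp
    qed (auto elim!: evenE simp: power2_eq_square)
    moreover have "(x\<^sup>2 mod 4 + y\<^sup>2 mod 4) mod 4 = 0" using that by (simp add: mod_add_eq)
    ultimately show ?thesis by (simp split: if_splits)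
  qed
  from this[OF J] obtain S V where SV: "phi (-1) = 2 * S" "phi b = 2 * V" by blast
  moreover have "int p = S\<^sup>2 + V\<^sup>2" using J SV by (simp add: power_mult_distrib)
  ultimately show ?thesis using that by blast
qed

subsection \<open>Differences of cyclotomic classes of order 4\<close>

text \<open>For \<open>e = 1\<close> and \<open>e = -1\<close> the supports of \<open>H e\<close> are the cyclotomic classes \<open>C\<^sub>0\<close> and
  \<open>C\<^sub>2\<close> of order 4: each is the set of squares of the elements of character \<open>e\<close>.\<close>

definition H :: "int \<Rightarrow> int \<Rightarrow> int" where
  "H e x = (\<Sum>v\<in>R. if [v\<^sup>2 = x] (mod int p) then if eta v = e then 1 else 0 else 0)"

text \<open>Four times the number of representations of \<open>z\<close> as a difference, since \<open>H\<close> takes the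
  values 0 and 2.\<close>

definition N :: "int \<Rightarrow> int \<Rightarrow> int" where
  "N e z = (\<Sum>x\<in>R. H e (x + z) * H (- e) x)"

lemma periodic_if_eta: "periodic (\<lambda>v. if eta (g v) = e then k else (l :: int))"
  if "\<And>x y. [x = y] (mod int p) \<Longrightarrow> [g x = g y] (mod int p)"
  using periodicD[OF eta_periodic that] by (auto simp: periodic_def)

lemma H_periodic: "periodic (H e)"
  unfolding periodic_def H_def by (auto simp: cong_def intro!: sum.cong)

lemma N_periodic: "periodic (N e)"
  unfolding periodic_def N_def
  by (intro allI impI sum.cong refl arg_cong2[of _ _ _ _ "(*)"] periodicD[OF H_periodic] cong_add cong_refl)

lemma sum_H:
  assumes g: "periodic g"
  shows "(\<Sum>x\<in>R. H e x * g x) = (\<Sum>v\<in>R. if eta v = e then g (v\<^sup>2) else 0)"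
proof -
  have "(\<Sum>x\<in>R. H e x * g x)
     = (\<Sum>v\<in>R. \<Sum>x\<in>R. if [v\<^sup>2 = x] (mod int p) then (if eta v = e then g x else 0) else 0)"
    unfolding H_def sum_distrib_right by (subst sum.swap) (auto intro!: sum.cong)
  also have "\<dots> = (\<Sum>v\<in>R. if eta v = e then g (v\<^sup>2) else 0)"
    by (intro sum.cong refl sum_delta_cong) (use g in \<open>auto simp: periodic_def\<close>)
  finally show ?thesis .
qed

text \<open>Multiplication by \<open>c\<close> carries the square roots of \<open>x\<close> to those
  of \<open>c^2 * x\<close> and multiplies their character by \<open>eta c\<close>; for a nonresidue
  \<open>c\<close> the two classes are exchanged.\<close>

lemma H_scale:
  assumes c: "\<not> int p dvd c" and e: "e \<in> {-1, 1}"
  shows "H e (c\<^sup>2 * x) = H (e * eta c) x"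
proof -
  have "[(c * v)\<^sup>2 = c\<^sup>2 * x] (mod int p) \<longleftrightarrow> [v\<^sup>2 = x] (mod int p)" for v
  proof -
    have "(c * v)\<^sup>2 - c\<^sup>2 * x = c * (c * (v\<^sup>2 - x))" by (simp add: power2_eq_square algebra_simps)
    then show ?thesis using c prime_dvd_mult_iff[OF prime_int] by (simp add: cong_iff_dvd_diff)
  qed
  moreover have "eta (c * v) = e \<longleftrightarrow> eta v = e * eta c" for v
    using e eta_values[of c] eta_values[of v] eta_eq_0_iff[of c] c by (auto simp: eta_mult)
  moreover have "periodic (\<lambda>v. if [v\<^sup>2 = c\<^sup>2 * x] (mod int p) then if eta v = e then 1 else (0::int) else 0)"
    using periodicD[OF eta_periodic] by (auto simp: periodic_def) (metis cong_pow cong_sym cong_trans)+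
  note sum_scale[OF this c, symmetric]
  ultimately show ?thesis by (simp add: H_def cong: if_cong)
qed

text \<open>Since \<open>eta (- w) = eta w\<close>, either both square roots of a nonzero square are
  counted or neither is.\<close>

lemma H_values:
  assumes p4: "p mod 4 = 1" and e: "e \<in> {-1, 1}"
  shows "H e x = 0 \<or> H e x = 2 \<and> (\<exists>w. eta w = e \<and> [w\<^sup>2 = x] (mod int p))"
proof (cases "\<exists>w. eta w = e \<and> [w\<^sup>2 = x] (mod int p)")
  case True
  then obtain w where w: "eta w = e" "[w\<^sup>2 = x] (mod int p)" by blast
  then have nd: "\<not> int p dvd w" using eta_eq_0_iff[of w] e by auto
  have "H e x = H e (w\<^sup>2)" by (rule periodicD[OF H_periodic]) (use w cong_sym in blast)
  also have "\<dots> = (\<Sum>v\<in>R. if [w\<^sup>2 = v\<^sup>2] (mod int p) then if eta v = e then 1 else 0 else 0)"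
    unfolding H_def by (intro sum.cong refl) (simp add: cong_sym_eq)
  also have "\<dots> = (if eta w = e then 1 else 0) + (if eta (- w) = e then 1 else 0)"
    by (rule sum_square_fibre[OF _ nd]) (rule periodic_if_eta)
  also have "\<dots> = 2" using w eta_uminus[OF p4] by simp
  finally show ?thesis using True by blast
next
  case False
  then have "H e x = 0" unfolding H_def by (intro sum.neutral) auto
  then show ?thesis ..
qed

lemma H_disjoint:
  assumes p4: "p mod 4 = 1" and e: "e \<in> {-1, 1}"
  shows "H e x * H (- e) x = 0"
proof (rule ccontr)
  assume "H e x * H (- e) x \<noteq> 0"
  then obtain v w where vw: "eta v = e" "[v\<^sup>2 = x] (mod int p)" "eta w = - e" "[w\<^sup>2 = x] (mod int p)"
    using H_values[OF p4 e, of x] H_values[OF p4, of "- e" x] e by auto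
  then have "[v\<^sup>2 = w\<^sup>2] (mod int p)" by (metis cong_sym cong_trans)
  then have "eta v = eta w"
    using periodicD[OF eta_periodic] eta_uminus[OF p4] unfolding cong_square_iff by metis
  then show False using vw e by auto
qed

lemma sum_H_total:
  assumes "e \<in> {-1, 1}"
  shows "2 * (\<Sum>x\<in>R. H e x) = int p - 1"
proof -
  have "(\<Sum>x\<in>R. H e x) = (\<Sum>v\<in>R. if eta v = e then 1 else 0)"
    using sum_H[of "\<lambda>_. 1" e] by (simp add: periodic_def)
  then show ?thesis using count_eta_eq[OF assms] by simp
qed

text \<open>For a square root \<open>i\<close> of -1, Euler's criterion gives \<open>eta i\<close>
  as \<open>(-1) ^ ((p - 1) div 4)\<close>, and this exponent is even.\<close>

lemma minus_1_fourth_power: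
  assumes p8: "p mod 8 = 1"
  obtains i where "[i\<^sup>2 = -1] (mod int p)" "eta i = 1"
proof -
  have p4: "p mod 4 = 1" using p8 by presburger
  obtain i where i: "[i\<^sup>2 = -1] (mod int p)" "\<not> int p dvd i"
    by (rule eta_eq_1E[OF eta_minus_1[OF p4]])
  have e: "(p - 1) div 2 = 2 * ((p - 1) div 4)" "even ((p - 1) div 4)"
    using p8 by presburger+
  have "[eta i = (i\<^sup>2) ^ ((p - 1) div 4)] (mod int p)"
    using euler_criterion[OF prime gt_2, of i] unfolding e(1) by (simp add: eta_def power_mult)
  moreover have "[(i\<^sup>2) ^ ((p - 1) div 4) = (-1) ^ ((p - 1) div 4)] (mod int p)"
    by (rule cong_pow[OF i(1)])
  ultimately have "[eta i = 1] (mod int p)" using e(2) cong_trans by fastforce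
  then have d: "int p dvd eta i - 1" by (simp add: cong_iff_dvd_diff)
  have "\<bar>eta i - 1\<bar> \<le> 2" using eta_values[of i] by auto
  then have "eta i = 1" using dvd_imp_le_int[OF _ d] gt_2 by fastforce
  then show ?thesis using that i(1) by blast
qed

lemma H_uminus:
  assumes p8: "p mod 8 = 1" and e: "e \<in> {-1, 1}"
  shows "H e (- x) = H e x"
proof -
  obtain i where i: "[i\<^sup>2 = -1] (mod int p)" "eta i = 1" by (rule minus_1_fourth_power[OF p8])
  have nd: "\<not> int p dvd i" using i eta_eq_0_iff[of i] by auto
  have "H e (- x) = H e (i\<^sup>2 * x)"
    using cong_mult[OF i(1) cong_refl, of x] by (intro periodicD[OF H_periodic]) (simp add: cong_sym_eq)
  then show ?thesis using H_scale[OF nd e] i(2) by simp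
qed

text \<open>The substitution of \<open>- x - z\<close> for \<open>x\<close> exchanges the two
  factors up to sign, and both classes are closed under negation.\<close>

lemma N_swap:
  assumes p8: "p mod 8 = 1" and e: "e \<in> {-1, 1}"
  shows "N (- e) z = N e z"
proof -
  have per: "periodic (\<lambda>x. H (- e) (x + z) * H e x)"
    unfolding periodic_def using periodicD[OF H_periodic] by (metis cong_add cong_refl)
  have nd: "\<not> int p dvd - 1" using not_dvd_1 by simp
  have "N (- e) z = (\<Sum>x\<in>R. H (- e) (- 1 * x + - z + z) * H e (- 1 * x + - z))"
    unfolding N_def using sum_affine[OF per nd, of "- z"] by simp
  also have "\<dots> = (\<Sum>x\<in>R. H (- e) (- x) * H e (- (x + z)))" by (simp add: algebra_simps)
  also have "\<dots> = N e z"
    unfolding N_def using e by (intro sum.cong refl) (subst (1 2) H_uminus[OF p8]; auto)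
  finally show ?thesis .
qed

text \<open>Scaling the summation variable by \<open>c^2\<close> replaces \<open>e\<close> by
  \<open>e * eta c\<close>, and exchanging the classes leaves the count unchanged.\<close>

lemma N_scale:
  assumes p8: "p mod 8 = 1" and e: "e \<in> {-1, 1}" and c: "\<not> int p dvd c"
  shows "N e (c\<^sup>2 * z) = N e z"
proof -
  have c2: "\<not> int p dvd c\<^sup>2" using c prime_dvd_power[OF prime_int] by blast
  have per: "periodic (\<lambda>x. H e (x + c\<^sup>2 * z) * H (- e) x)"
    unfolding periodic_def using periodicD[OF H_periodic] by (metis cong_add cong_refl)
  have "N e (c\<^sup>2 * z) = (\<Sum>x\<in>R. H e (c\<^sup>2 * (x + z)) * H (- e) (c\<^sup>2 * x))"
    unfolding N_def using sum_scale[OF per c2] by (simp add: algebra_simps)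
  also have "\<dots> = N (e * eta c) z"
    unfolding N_def using e by (intro sum.cong refl) (subst (1 2) H_scale[OF c]; auto)
  also have "\<dots> = N e z"
    using N_swap[OF p8 e] eta_values[of c] eta_eq_0_iff[of c] c by auto
  finally show ?thesis .
qed

section \<open>Evaluation of the difference counts\<close>

lemma N_0: "p mod 4 = 1 \<Longrightarrow> e \<in> {-1, 1} \<Longrightarrow> N e 0 = 0"
  unfolding N_def using H_disjoint by (intro sum.neutral) auto

lemma four_dvd_N: "p mod 4 = 1 \<Longrightarrow> e \<in> {-1, 1} \<Longrightarrow> 4 dvd N e z"
  unfolding N_def
proof (rule dvd_sum)
  fix x assume p4: "p mod 4 = 1" and e: "e \<in> {-1, 1}"
  then have "2 dvd H e (x + z)" "2 dvd H (- e) x"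
    using H_values[OF p4 e, of "x + z"] H_values[OF p4, of "- e" x] by auto
  then show "4 dvd H e (x + z) * H (- e) x"
    using mult_dvd_mono[of 2 "H e (x + z)" 2 "H (- e) x"] by simp
qed

lemma sum_N: "4 * (\<Sum>z\<in>R. N 1 z) = (int p - 1)\<^sup>2"
proof -
  have "(\<Sum>z\<in>R. N 1 z) = (\<Sum>x\<in>R. \<Sum>z\<in>R. H 1 (z + x) * H (- 1) x)"
    unfolding N_def by (subst sum.swap) (simp add: add.commute)
  also have "\<dots> = (\<Sum>x\<in>R. H 1 x) * (\<Sum>x\<in>R. H (- 1) x)"
    by (simp add: sum_shift[OF H_periodic] flip: sum_distrib_right sum_distrib_left)
  finally have "4 * (\<Sum>z\<in>R. N 1 z) = (2 * (\<Sum>x\<in>R. H 1 x)) * (2 * (\<Sum>x\<in>R. H (- 1) x))"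
    by simp
  then show ?thesis using sum_H_total[of 1] sum_H_total[of "-1"] by (simp add: power2_eq_square)
qed

text \<open>On units, twice the indicator of character -1 is \<open>1 - eta w\<close>. This splits
  the sum into a two-shift sum and a Jacobsthal sum.\<close>

lemma sum_eta_1_minus_square:
  assumes p4: "p mod 4 = 1"
  shows "2 * (\<Sum>w\<in>R. if eta w = -1 then eta (1 - w\<^sup>2) else 0) = - 2 - phi (- 1)"
proof -
  have 1: "eta (1 - w\<^sup>2) = eta ((w + 1) * (w + - 1))" for w
    using eta_uminus[OF p4, of "1 - w\<^sup>2"] by (simp add: power2_eq_square algebra_simps)
  have "\<not> [1 = - 1] (mod int p)" using not_dvd_2 by (simp add: cong_iff_dvd_diff)
  then have "(\<Sum>w\<in>R. eta (1 - w\<^sup>2)) = - 1"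
    unfolding 1 sum_eta_two_shifts by simp
  \<comment> \<open>The value drops from -1 to -2 because \<open>w = 0\<close> contributes
    \<open>eta 1 = 1\<close>.\<close>
  then have 2: "(\<Sum>w\<in>R - {0}. eta (1 - w\<^sup>2)) = - 2"
    using sum_R_split_0[of "\<lambda>w. eta (1 - w\<^sup>2)"] eta_1 by simp
  have "(\<Sum>w\<in>R. eta w * eta (1 - w\<^sup>2)) = phi (-1)"
    unfolding phi_def using eta_uminus[OF p4] by (metis (no_types, lifting) eta_mult minus_diff_eq
      uminus_add_conv_diff add.commute)
  then have 3: "(\<Sum>w\<in>R - {0}. eta w * eta (1 - w\<^sup>2)) = phi (-1)"
    using sum_R_split_0[of "\<lambda>w. eta w * eta (1 - w\<^sup>2)"] eta_eq_0_iff[of 0] by simp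
  have "2 * (\<Sum>w\<in>R. if eta w = -1 then eta (1 - w\<^sup>2) else 0)
    = (\<Sum>w\<in>R - {0}. 2 * (if eta w = -1 then eta (1 - w\<^sup>2) else 0))"
    using sum_R_split_0[of "\<lambda>w. if eta w = -1 then eta (1 - w\<^sup>2) else 0"] eta_eq_0_iff[of 0]
    by (simp add: sum_distrib_left)
  also have "\<dots> = (\<Sum>w\<in>R - {0}. eta (1 - w\<^sup>2) - eta w * eta (1 - w\<^sup>2))"
  proof (rule sum.cong[OF refl])
    fix w assume "w \<in> R - {0}"
    then have "eta w \<noteq> 0" using in_R_dvd[of w] eta_eq_0_iff[of w] by blast
    then show "2 * (if eta w = -1 then eta (1 - w\<^sup>2) else 0) = eta (1 - w\<^sup>2) - eta w * eta (1 - w\<^sup>2)"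
      using eta_values[of w] by auto
  qed
  also have "\<dots> = - 2 - phi (- 1)" by (simp only: sum_subtractf 2 3)
  finally show ?thesis .
qed

text \<open>After exchanging summations, the sum runs over \<open>C\<^sub>0\<close> with weight
  \<open>K\<close>. Scaling by \<open>v^2\<close> with \<open>eta v = 1\<close> preserves
  \<open>C\<^sub>2\<close>, so \<open>K\<close> is constant on \<open>C\<^sub>0\<close>, and
  \<open>K 1\<close> is the sum evaluated before.\<close>

lemma sum_eta_N:
  assumes p4: "p mod 4 = 1"
  shows "4 * (\<Sum>z\<in>R. eta z * N 1 z) = (int p - 1) * (- 2 - phi (- 1))"
proof -
  define K where "K y = (\<Sum>x\<in>R. H (- 1) x * eta (y - x))" for y
  have perK: "periodic K"
    unfolding periodic_def K_def
    by (auto intro!: sum.cong arg_cong2[of _ _ _ _ "(*)"] periodicD[OF eta_periodic] cong_diff)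
  have per: "periodic (\<lambda>z. eta (z - x) * H 1 z)" for x
    unfolding periodic_def using periodicD[OF H_periodic] periodicD[OF eta_periodic]
    by (metis cong_diff cong_refl)
  \<comment> \<open>The form \<open>z + x - x\<close> exhibits the summand as a shift by
    \<open>x\<close> of a periodic function of \<open>z\<close>.\<close>
  have "(\<Sum>z\<in>R. eta z * N 1 z) = (\<Sum>x\<in>R. \<Sum>z\<in>R. H (- 1) x * (eta (z + x - x) * H 1 (z + x)))"
    unfolding N_def sum_distrib_left by (subst sum.swap) (simp add: ac_simps)
  also have "\<dots> = (\<Sum>x\<in>R. \<Sum>z\<in>R. H (- 1) x * (eta (z - x) * H 1 z))"
    by (simp only: sum_shift[OF per] sum_distrib_left[symmetric])
  also have "\<dots> = (\<Sum>y\<in>R. H 1 y * K y)"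
    unfolding K_def sum_distrib_left by (subst sum.swap) (simp add: ac_simps)
  also have "\<dots> = (\<Sum>v\<in>R. if eta v = 1 then K (v\<^sup>2) else 0)"
    by (rule sum_H[OF perK])
  also have "\<dots> = (\<Sum>v\<in>R. (if eta v = 1 then 1 else 0) * K 1)"
  proof (intro sum.cong refl)
    fix v
    have "K (v\<^sup>2) = K 1" if v: "eta v = 1"
    proof -
      have nd: "\<not> int p dvd v" using v eta_eq_0_iff[of v] by auto
      then have nd2: "\<not> int p dvd v\<^sup>2" using prime_dvd_power[OF prime_int] by blast
      have perx: "periodic (\<lambda>x. H (- 1) x * eta (v\<^sup>2 - x))"
        unfolding periodic_def using periodicD[OF H_periodic] periodicD[OF eta_periodic]
        by (metis cong_diff cong_refl)
      have "K (v\<^sup>2) = (\<Sum>x\<in>R. H (- 1) (v\<^sup>2 * x) * eta (v\<^sup>2 - v\<^sup>2 * x))"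
        unfolding K_def using sum_scale[OF perx nd2] by simp
      also have "\<dots> = (\<Sum>x\<in>R. H (- 1) x * eta (v\<^sup>2 * (1 - x)))"
        using H_scale[OF nd, of "-1"] v by (simp add: right_diff_distrib)
      also have "\<dots> = K 1"
        unfolding K_def eta_mult[of "v\<^sup>2"] eta_square[OF nd] by simp
      finally show ?thesis .
    qed
    then show "(if eta v = 1 then K (v\<^sup>2) else 0) = (if eta v = 1 then 1 else 0) * K 1" by simp
  qed
  also have "4 * \<dots> = (\<Sum>v\<in>R. if eta v = 1 then 1 else 0) * 2 * (2 * K 1)"
    by (simp only: sum_distrib_right[symmetric])
  also have "K 1 = (\<Sum>w\<in>R. if eta w = -1 then eta (1 - w\<^sup>2) else 0)"
    unfolding K_def by (rule sum_H) (intro periodic_eta cong_diff cong_refl)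
  finally show ?thesis
    unfolding count_eta_eq[of 1, simplified] sum_eta_1_minus_square[OF p4] .
qed

lemma N_eq:
  fixes t :: int
  assumes t: "int p = 1 + 16 * t\<^sup>2" and e: "e \<in> {-1, 1}" and z: "\<not> int p dvd z"
  shows "4 * N e z = int p - 1"
proof -
  have "int p mod 8 = 1" unfolding t by presburger
  then have p8: "p mod 8 = 1" by presburger
  then have p4: "p mod 4 = 1" by presburger
  obtain g where g: "eta g = -1" by (rule non_residueE)
  obtain S V where SV: "phi (-1) = 2 * S" "phi g = 2 * V" "int p = S\<^sup>2 + V\<^sup>2"
    by (rule phi_half[OF p4 g])
  have sc: "N 1 (c\<^sup>2 * x) = N 1 x" if "\<not> int p dvd c" for c x
    using N_scale[OF p8 _ that] by simp
  have cl: "2 * (\<Sum>x\<in>R. N 1 x) = 2 * N 1 0 + (int p - 1) * (N 1 1 + N 1 g)"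
    "2 * (\<Sum>x\<in>R. eta x * N 1 x) = (int p - 1) * (N 1 1 - N 1 g)"
    by (rule sum_class_function[OF _ N_periodic eta_1 g], erule sc)+
  have cl3: "N 1 z = (if eta z = 1 then N 1 1 else N 1 g)"
    by (rule sum_class_function(3)[OF _ N_periodic eta_1 g z], erule sc)
  have p1: "int p - 1 \<noteq> 0" using gt_2 by simp
  have "(int p - 1) * (2 * (N 1 1 + N 1 g)) = (int p - 1) * (int p - 1)"
    using cl(1) sum_N N_0[OF p4] by (simp add: power2_eq_square algebra_simps)
  then have plus: "2 * (N 1 1 + N 1 g) = int p - 1" using p1 by simp
  have "(int p - 1) * (2 * (N 1 1 - N 1 g)) = (int p - 1) * (- 2 - 2 * S)"
    using cl(2) sum_eta_N[OF p4] unfolding SV(1) by linarith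
  then have "2 * (N 1 1 - N 1 g) = - 2 - 2 * S" using p1 by simp
  then have minus: "N 1 1 - N 1 g = - 1 - S" by simp
  \<comment> \<open>This congruence decides the sign of \<open>S\<close> once its square is known to
    be 1, and its parity excludes \<open>V^2 = 1\<close>.\<close>
  then have "4 dvd - 1 - S"
    using four_dvd_N[OF p4, of 1 1] four_dvd_N[OF p4, of 1 g] by (metis dvd_diff insertI1 insert_commute)
  then have S4: "S mod 4 = 3" by presburger
  have "\<not> int p dvd S"
  proof
    assume d: "int p dvd S"
    have "S \<noteq> 0" using S4 by auto
    then have "int p \<le> \<bar>S\<bar>" using dvd_imp_le_int[OF _ d] by simp
    then have "(int p)\<^sup>2 \<le> S\<^sup>2" by (metis abs_ge_zero of_nat_0_le_iff power2_abs power_mono)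
    then have "int p * int p \<le> int p * 1" using SV(3) by (simp add: power2_eq_square) (smt (verit) zero_le_square)
    then show False using gt_2 by (simp add: mult_le_cancel_left)
  qed
  moreover have "int p ^ 1 = 1 + (4 * t)\<^sup>2" using t by simp
  ultimately have "S\<^sup>2 = 1 \<or> V\<^sup>2 = 1"
    using sum_two_squares_prime_power_unique[OF prime gt_2, of 1 "4 * t" S V] SV(3) by simp
  moreover have "V\<^sup>2 \<noteq> 1"
  proof
    assume "V\<^sup>2 = 1"
    then have "S\<^sup>2 = 16 * t\<^sup>2" using SV(3) t by simp
    then have "even S" by (metis even_mult_iff even_numeral even_power pos2)
    then show False using S4 by presburger
  qed
  ultimately have "S = 1 \<or> S = -1" by (simp add: power2_eq_1_iff)
  then have "S = -1" using S4 by auto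
  then have "N 1 1 = N 1 g" using minus by simp
  then have "4 * N 1 z = int p - 1" using plus cl3 by simp
  then show ?thesis using N_swap[OF p8, of 1] e by auto
qed

section \<open>The classes as subsets of the additive group of Z/p, written multiplicatively\<close>

definition Zp :: "int monoid" where "Zp = add_monoid (residue_ring (int p))"

lemma Zp_simps:
  "carrier Zp = R" "x \<otimes>\<^bsub>Zp\<^esub> y = (x + y) mod int p" "\<one>\<^bsub>Zp\<^esub> = 0"
  by (auto simp: Zp_def residue_ring_def)

lemma Zp_comm_group: "comm_group Zp"
proof -
  interpret residues "int p" "residue_ring (int p)"
    by unfold_locales (use gt_2 in auto)
  show ?thesis unfolding Zp_def by (rule abelian_group.a_comm_group[OF abelian_group])
qed

lemma Zp_inv: "y \<in> R \<Longrightarrow> inv\<^bsub>Zp\<^esub> y = (- y) mod int p"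
proof -
  assume y: "y \<in> R"
  interpret comm_group Zp by (rule Zp_comm_group)
  show ?thesis
  proof (rule inv_equality)
    show "(- y) mod int p \<otimes>\<^bsub>Zp\<^esub> y = \<one>\<^bsub>Zp\<^esub>"
      unfolding Zp_simps by (simp add: mod_simps)
  qed (use y mod_in_R in \<open>simp_all only: Zp_simps\<close>)
qed

definition C :: "int \<Rightarrow> int set" where "C e = {x \<in> R. H e x \<noteq> 0}"

lemma card_C:
  assumes p4: "p mod 4 = 1" and e: "e \<in> {-1, 1}"
  shows "4 * card (C e) = p - 1"
proof -
  have "(\<Sum>x\<in>R. H e x) = (\<Sum>x\<in>R. if H e x \<noteq> 0 then 2 else 0)"
    using H_values[OF p4 e] by (intro sum.cong) auto
  also have "\<dots> = 2 * int (card (C e))"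
    by (simp add: C_def flip: sum.inter_filter)
  finally have "4 * int (card (C e)) = int p - 1"
    using sum_H_total[OF e] by simp
  then show ?thesis by linarith
qed

text \<open>A pair with difference \<open>z\<close> is determined by its second entry, and each such
  pair contributes 2 * 2 to \<open>N e z\<close>.\<close>

lemma count_delta_C:
  assumes p4: "p mod 4 = 1" and e: "e \<in> {-1, 1}"
  shows "4 * int (count (delta_E Zp (C e) (C (- e))) z) = (if z \<in> R then N e z else 0)"
proof -
  let ?P = "{q \<in> C e \<times> C (- e). (fst q - snd q) mod int p = z}"
  have fin: "finite (C e)" for e by (rule finite_subset[of _ R]) (auto simp: C_def)
  have "delta_E Zp (C e) (C (- e)) = image_mset (\<lambda>q. (fst q - snd q) mod int p) (mset_set (C e \<times> C (- e)))"
    unfolding delta_E_def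
  proof (rule image_mset_cong)
    fix q assume "q \<in># mset_set (C e \<times> C (- e))"
    then have "q \<in> C e \<times> C (- e)" using fin by simp
    then show "(case q of (x, y) \<Rightarrow> x \<otimes>\<^bsub>Zp\<^esub> inv\<^bsub>Zp\<^esub> y) = (fst q - snd q) mod int p"
      by (auto simp: C_def Zp_simps(2) Zp_inv mod_simps)
  qed
  then have "count (delta_E Zp (C e) (C (- e))) z
      = (\<Sum>q | q \<in># mset_set (C e \<times> C (- e)) \<and> z = (fst q - snd q) mod int p.
          count (mset_set (C e \<times> C (- e))) q)"
    by (simp only: count_image_mset')
  also have "{q. q \<in># mset_set (C e \<times> C (- e)) \<and> z = (fst q - snd q) mod int p} = ?P"
    using fin by auto
  also have "(\<Sum>q\<in>?P. count (mset_set (C e \<times> C (- e))) q) = (\<Sum>q\<in>?P. 1)"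
    by (rule sum.cong[OF refl]) (use fin in \<open>simp add: count_mset_set(1)\<close>)
  finally have cnt: "count (delta_E Zp (C e) (C (- e))) z = card ?P"
    by (simp only: card_eq_sum)
  show ?thesis
  proof (cases "z \<in> R")
    case False
    then have "?P = {}" using mod_in_R by auto
    then show ?thesis using cnt False by (simp only: card.empty) simp
  next
    case True
    let ?Q = "{y \<in> R. H e (y + z) \<noteq> 0 \<and> H (- e) y \<noteq> 0}"
    have "bij_betw (\<lambda>y. ((y + z) mod int p, y)) ?Q ?P"
    proof (rule bij_betwI[where g = snd])
      show "(\<lambda>y. ((y + z) mod int p, y)) \<in> ?Q \<rightarrow> ?P"
        using True mod_in_R periodicD[OF H_periodic cong_mod_p] by (auto simp: C_def mod_simps)
      show "snd \<in> ?P \<rightarrow> ?Q"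
      proof
        fix q assume "q \<in> ?P"
        then obtain x y where q: "q = (x, y)" "x \<in> C e" "y \<in> C (- e)" "(x - y) mod int p = z" by auto
        have "[y + z = x] (mod int p)" unfolding q(4)[symmetric] by (simp add: cong_def mod_simps)
        then have "H e (y + z) = H e x" by (rule periodicD[OF H_periodic])
        then show "snd q \<in> ?Q" using q by (simp add: C_def)
      qed
      show "((snd q + z) mod int p, snd q) = q" if "q \<in> ?P" for q
        using that by (auto simp: C_def mod_simps)
    qed simp
    then have "card ?P = card ?Q" by (rule bij_betw_same_card[symmetric])
    have "N e z = (\<Sum>y\<in>R. if H e (y + z) \<noteq> 0 \<and> H (- e) y \<noteq> 0 then 4 else 0)"
      unfolding N_def
    proof (rule sum.cong[OF refl])
      fix y
      have "H e (y + z) \<in> {0, 2}" "H (- e) y \<in> {0, 2}"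
        using H_values[OF p4 e, of "y + z"] H_values[OF p4, of "- e" y] e by auto
      then show "H e (y + z) * H (- e) y = (if H e (y + z) \<noteq> 0 \<and> H (- e) y \<noteq> 0 then 4 else 0)"
        by auto
    qed
    also have "\<dots> = (\<Sum>y\<in>?Q. 4)"
      by (rule sum.inter_filter[symmetric]) simp
    finally have "N e z = 4 * int (card ?Q)"
      by (simp only: sum_constant)
    then show ?thesis using cnt \<open>card ?P = card ?Q\<close> True by (simp only: if_True)
  qed
qed

text \<open>With two members each union is a single difference multiset: \<open>e = -1\<close>
  serves \<open>j = 1\<close> and \<open>e = 1\<close> serves \<open>j = 2\<close>.\<close>

lemma is_sedf_C:
  assumes t: "int p = 1 + 16 * t\<^sup>2"
  shows "is_sedf Zp p 2 ((p - 1) div 4) ((p - 1) div 16) (\<lambda>j. C (if j = 1 then 1 else - 1))"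
proof -
  have "t \<noteq> 0" using t gt_2 by auto
  then have "1 \<le> t\<^sup>2" by (metis zero_less_power2 zless_imp_add1_zle add_0)
  \<comment> \<open>This bound makes both the block size and the multiplicity positive.\<close>
  then have "17 \<le> p" using t by linarith
  then have pos: "0 < (p - 1) div 4" "0 < (p - 1) div 16" by (simp_all add: div_greater_zero_iff)
  have "int p mod 4 = 1" unfolding t by presburger
  then have p4: "p mod 4 = 1" by presburger
  have dif: "delta_E Zp (C e) (C (- e)) = repeat_mset ((p - 1) div 16) (mset_set (carrier Zp - {\<one>\<^bsub>Zp\<^esub>}))"
    if e: "e \<in> {-1, 1}" for e
  proof (rule multiset_eqI)
    fix z
    show "count (delta_E Zp (C e) (C (- e))) z =
      count (repeat_mset ((p - 1) div 16) (mset_set (carrier Zp - {\<one>\<^bsub>Zp\<^esub>}))) z"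
    proof (cases "z \<in> R - {0}")
      case True
      then have "\<not> int p dvd z" using in_R_dvd by blast
      then have "16 * int (count (delta_E Zp (C e) (C (- e))) z) = int p - 1"
        using N_eq[OF t e, of z] count_delta_C[OF p4 e, of z] True by (simp split: if_splits)
      then have "count (delta_E Zp (C e) (C (- e))) z = (p - 1) div 16" by linarith
      then show ?thesis using True unfolding Zp_simps by simp
    next
      case False
      then have "count (delta_E Zp (C e) (C (- e))) z = 0"
        using N_0[OF p4 e] count_delta_C[OF p4 e, of z] by (auto split: if_splits)
      then show ?thesis using False unfolding Zp_simps by (auto simp: count_mset_set')
    qed
  qed
  have disj: "C 1 \<inter> C (- 1) = {}"
    using H_disjoint[OF p4, of 1] by (auto simp: C_def)
  have two: "{1..2::nat} = {1, 2}" by auto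
  have "card (C e) = (p - 1) div 4" if "e \<in> {-1, 1}" for e
    using card_C[OF p4 that] by linarith
  moreover have "C e \<subseteq> R" for e by (auto simp: C_def)
  moreover have "order Zp = p" unfolding order_def Zp_simps by simp
  moreover have "(\<Sum>i\<in>{1, 2} - {1::nat}. delta_E Zp (C (if i = 1 then 1 else - 1)) (C 1)) = delta_E Zp (C (- 1)) (C 1)"
    "(\<Sum>i\<in>{1, 2} - {2::nat}. delta_E Zp (C (if i = 1 then 1 else - 1)) (C (- 1))) = delta_E Zp (C 1) (C (- 1))"
    by (simp_all add: insert_Diff_if)
  moreover have "disjoint_family_on (\<lambda>j. C (if j = 1 then 1 else - 1)) {1, 2::nat}"
    using disj by (auto simp: disjoint_family_on_def)
  ultimately show ?thesis
    unfolding is_sedf_def two using Zp_comm_group pos dif[of 1] dif[of "-1"]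
    unfolding Zp_simps by simp
qed

end

section \<open>Reduction from prime powers to primes\<close>

theorem theorem4p3:
  fixes q :: nat and t :: int
  assumes "primepow q"
    and "int q = 1 + 16 * t\<^sup>2"
  shows "sedf_exists q 2 ((q - 1) div 4) ((q - 1) div 16)"
proof -
  obtain p n where p: "Factorial_Ring.prime p" and n: "0 < n" and q: "q = p ^ n"
    using assms(1) by (auto simp: primepow_def)
  have Y: "int p ^ n = 1 + (4 * t)\<^sup>2" using assms(2) q by simp
  have "odd (int p ^ n)" unfolding Y by simp
  then have "odd p" using n by simp
  then have gt_2: "2 < p" using prime_ge_2_nat[OF p] by (cases "p = 2") auto
  interpret odd_prime p by unfold_locales (fact p, fact gt_2)
  have "odd n"
  proof
    assume "even n"
    then obtain k where k: "n = 2 * k" by blast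
    then have sq: "(int p ^ k)\<^sup>2 = 1 + (4 * t)\<^sup>2" using Y by (simp add: power_mult mult.commute)
    \<comment> \<open>Two squares differing by 1 factor as a product equal to 1, which is too small
      for a positive power of \<open>p\<close>.\<close>
    then have "(int p ^ k - \<bar>4 * t\<bar>) * (int p ^ k + \<bar>4 * t\<bar>) = 1"
      by (simp add: power2_eq_square algebra_simps)
    then have "int p ^ k + \<bar>4 * t\<bar> dvd 1" by (metis dvd_triv_right)
    then have "int p ^ k + \<bar>4 * t\<bar> = 1" using p_pos by (simp add: zdvd1_eq)
    moreover have "1 < int p ^ k" using k n gt_2 by (intro one_less_power) auto
    ultimately show False by simp
  qed
  \<comment> \<open>An odd power of a prime congruent to 3 modulo 4 is again congruent to 3, unlike
    \<open>1 + 16 * t^2\<close>.\<close>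
  have "p mod 4 = 1"
  proof (rule ccontr)
    assume "p mod 4 \<noteq> 1"
    then have "p mod 4 = 3" using \<open>odd p\<close> by presburger
    then have "[int p = - 1] (mod 4)" by (simp add: cong_def) presburger
    then have "[int p ^ n = (- 1) ^ n] (mod 4)" by (rule cong_pow)
    then have "4 dvd 2 + 16 * t\<^sup>2" using \<open>odd n\<close> Y by (simp add: cong_iff_dvd_diff)
    then show False by presburger
  qed
  \<comment> \<open>Jacobsthal's identity provides the representation of \<open>p\<close> as a sum
    of two squares that the special case of Lebesgue's theorem takes as input.\<close>
  obtain g where "eta g = -1" by (rule non_residueE)
  with \<open>p mod 4 = 1\<close> obtain S V where "int p = S\<^sup>2 + V\<^sup>2" by (rule phi_half)
  then have "n = 1"
    by (rule prime_power_eq_square_plus_1[OF p gt_2 _ \<open>odd n\<close> Y])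
  then have "q = p" using q by simp
  with assms(2) have "int p = 1 + 16 * t\<^sup>2" by blast
  then show ?thesis
    unfolding \<open>q = p\<close> by (rule is_sedf_imp_sedf_exists[OF is_sedf_C])
qed

end
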